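(* Let $\mathcal{D}=(\mathcal{P},\mathcal{B})$ be a non-trivial $2$-$(v,3,\lambda)$ design with $v\equiv 1,3\pmod{6}$ and $v\equiv 6\pmod{\lambda}$, admitting a flag-transitive automorphism group $G$ that acts $2$-transitively on $\mathcal{P}$. If $G$ is of affine type, then $\mathcal{D}\cong AG_h(3)$ for some $h$. *)

theory Defs
  imports
    "HOL-Algebra.Bij"
    "HOL-Algebra.Generated_Groups"
    "HOL-Number_Theory.Residues"
begin

section \<open>Designs\<close>

text \<open>
  The blocks form a set of point sets, so there are no repeated blocks, and incidence is
  membership. The condition \<open>0 < lambda\<close> excludes the empty block set.
\<close>

definition is_2_design :: "'a set \<Rightarrow> 'a set set \<Rightarrow> nat \<Rightarrow> nat \<Rightarrow> nat \<Rightarrow> bool" where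
  "is_2_design P \<B> v k lambda \<longleftrightarrow>
     finite P \<and> card P = v \<and> 0 < lambda \<and>
     (\<forall>B\<in>\<B>. B \<subseteq> P \<and> card B = k) \<and>
     (\<forall>x\<in>P. \<forall>y\<in>P. x \<noteq> y \<longrightarrow> card {B \<in> \<B>. x \<in> B \<and> y \<in> B} = lambda)"

definition nontrivial_2_design :: "'a set \<Rightarrow> 'a set set \<Rightarrow> nat \<Rightarrow> nat \<Rightarrow> nat \<Rightarrow> bool" where
  "nontrivial_2_design P \<B> v k lambda \<longleftrightarrow> is_2_design P \<B> v k lambda \<and> 2 < k \<and> k < v"

definition design_iso :: "'a set \<Rightarrow> 'a set set \<Rightarrow> 'b set \<Rightarrow> 'b set set \<Rightarrow> bool" where
  "design_iso P \<B> P' \<B>' \<longleftrightarrow> (\<exists>f. bij_betw f P P' \<and> (\<lambda>B. f ` B) ` \<B> = \<B>')"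

definition design_auts :: "'a set \<Rightarrow> 'a set set \<Rightarrow> ('a \<Rightarrow> 'a) set" where
  "design_auts P \<B> = {f \<in> Bij P. (\<lambda>B. f ` B) ` \<B> = \<B>}"

definition automorphism_group :: "'a set \<Rightarrow> 'a set set \<Rightarrow> ('a \<Rightarrow> 'a) set \<Rightarrow> bool" where
  "automorphism_group P \<B> G \<longleftrightarrow> subgroup G (BijGroup P) \<and> G \<subseteq> design_auts P \<B>"

definition flag_transitive :: "'a set set \<Rightarrow> ('a \<Rightarrow> 'a) set \<Rightarrow> bool" where
  "flag_transitive \<B> G \<longleftrightarrow>
     (\<forall>B\<in>\<B>. \<forall>C\<in>\<B>. \<forall>x\<in>B. \<forall>y\<in>C. \<exists>g\<in>G. g x = y \<and> g ` B = C)"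

section \<open>Permutation groups\<close>

definition two_transitive :: "'a set \<Rightarrow> ('a \<Rightarrow> 'a) set \<Rightarrow> bool" where
  "two_transitive P G \<longleftrightarrow>
     (\<forall>x\<in>P. \<forall>y\<in>P. \<forall>x'\<in>P. \<forall>y'\<in>P. x \<noteq> y \<longrightarrow> x' \<noteq> y' \<longrightarrow> (\<exists>g\<in>G. g x = x' \<and> g y = y'))"

definition regular_on :: "'a set \<Rightarrow> ('a \<Rightarrow> 'a) set \<Rightarrow> bool" where
  "regular_on P N \<longleftrightarrow> (\<forall>x\<in>P. \<forall>y\<in>P. \<exists>!g. g \<in> N \<and> g x = y)"

definition elementary_abelian :: "nat \<Rightarrow> ('a, 'b) monoid_scheme \<Rightarrow> bool" where
  "elementary_abelian p G \<longleftrightarrow>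
     prime p \<and> comm_group G \<and> (\<forall>x\<in>carrier G. x [^]\<^bsub>G\<^esub> p = \<one>\<^bsub>G\<^esub>)"

definition minimal_normal :: "'a set \<Rightarrow> ('a, 'b) monoid_scheme \<Rightarrow> bool" where
  "minimal_normal N G \<longleftrightarrow>
     N \<lhd> G \<and> N \<noteq> {\<one>\<^bsub>G\<^esub>} \<and> (\<forall>M. M \<lhd> G \<longrightarrow> M \<subseteq> N \<longrightarrow> M = {\<one>\<^bsub>G\<^esub>} \<or> M = N)"

definition socle :: "('a, 'b) monoid_scheme \<Rightarrow> 'a set" where
  "socle G = generate G (\<Union>{N. minimal_normal N G})"

definition perm_group :: "'a set \<Rightarrow> ('a \<Rightarrow> 'a) set \<Rightarrow> ('a \<Rightarrow> 'a) monoid" where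
  "perm_group P G = BijGroup P\<lparr>carrier := G\<rparr>"

text \<open>
  Affine type as in the O'Nan--Scott theorem: the socle is an elementary abelian
  \<open>p\<close>-group acting regularly on the points (it is the translation group when the points are
  identified with a vector space over the field with \<open>p\<close> elements).
\<close>

definition affine_type :: "'a set \<Rightarrow> ('a \<Rightarrow> 'a) set \<Rightarrow> bool" where
  "affine_type P G \<longleftrightarrow>
     (\<exists>p. elementary_abelian p (perm_group P (socle (perm_group P G)))) \<and>
     regular_on P (socle (perm_group P G))"

section \<open>Points and lines of affine space\<close>

text \<open>
  The \<open>h\<close>-dimensional affine space over a field \<open>F\<close>: points are the coordinate vectors,
  lines are the sets \<open>{a + t d | t}\<close> with \<open>d\<close> nonzero.
\<close>

definition ag_points :: "('a, 'b) ring_scheme \<Rightarrow> nat \<Rightarrow> (nat \<Rightarrow> 'a) set" where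
  "ag_points F h = {..<h} \<rightarrow>\<^sub>E carrier F"

definition ag_line ::
  "('a, 'b) ring_scheme \<Rightarrow> nat \<Rightarrow> (nat \<Rightarrow> 'a) \<Rightarrow> (nat \<Rightarrow> 'a) \<Rightarrow> (nat \<Rightarrow> 'a) set" where
  "ag_line F h a d =
     (\<lambda>t. \<lambda>i\<in>{..<h}. a i \<oplus>\<^bsub>F\<^esub> (t \<otimes>\<^bsub>F\<^esub> d i)) ` carrier F"

definition ag_lines :: "('a, 'b) ring_scheme \<Rightarrow> nat \<Rightarrow> (nat \<Rightarrow> 'a) set set" where
  "ag_lines F h =
     {ag_line F h a d | a d. a \<in> ag_points F h \<and> d \<in> ag_points F h \<and> (\<exists>i<h. d i \<noteq> \<zero>\<^bsub>F\<^esub>)}"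

end

theory Submission
  imports Defs "HOL-Algebra.Group_Action" "HOL-Algebra.Sylow"
begin

text \<open>
  Since \<open>v\<close> is odd and \<open>lambda\<close> divides \<open>v - 6\<close>, \<open>lambda\<close> is odd. Fix points \<open>x \<noteq> y\<close> and let
  \<open>T\<close> be a Sylow 2-subgroup of the setwise stabilizer of \<open>{x, y}\<close>, which contains the pointwise
  stabilizer with index 2. The \<open>lambda\<close> points completing \<open>{x, y}\<close> to a block are permuted by \<open>T\<close>,
  so \<open>T\<close> fixes one of them, say \<open>z\<close>. Taking \<open>z\<close> as the origin of the affine space, \<open>T\<close> fixes the
  vector \<open>x + y\<close>; were it nonzero, \<open>T\<close> would lie in a two-point stabilizer, whose order is not
  divisible by the order of \<open>T\<close>. Hence every pair of points lies in a block together with its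
  midpoint. By flag-transitivity the block \<open>{x, y, z}\<close> also has \<open>x\<close> as a midpoint of the other two
  points, which forces characteristic 3, and all blocks are images of this line.
\<close>

section \<open>Coordinates on elementary abelian groups\<close>

lemma residue_ring_simps [simp]:
  "carrier (residue_ring m) = {0..m - 1}"
  "x \<oplus>\<^bsub>residue_ring m\<^esub> y = (x + y) mod m"
  "x \<otimes>\<^bsub>residue_ring m\<^esub> y = x * y mod m"
  "\<zero>\<^bsub>residue_ring m\<^esub> = 0"
  by (simp_all add: residue_ring_def)

text \<open>The vector \<open>a + t d\<close> with coordinates reduced modulo \<open>m\<close>. The
  scalar \<open>t\<close> may be any integer, so this one operation yields sums
  (\<open>t = 1\<close>), negatives (\<open>t = - 1\<close>) and the points of a line.\<close>

definition affine_comb :: "int \<Rightarrow> nat \<Rightarrow> (nat \<Rightarrow> int) \<Rightarrow> int \<Rightarrow> (nat \<Rightarrow> int) \<Rightarrow> nat \<Rightarrow> int" where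
  "affine_comb m h a t d = (\<lambda>i\<in>{..<h}. (a i + t * d i) mod m)"

lemma ag_line_residue_ring:
  "ag_line (residue_ring m) h a d = (\<lambda>t. affine_comb m h a t d) ` {0..m - 1}"
  by (simp add: ag_line_def affine_comb_def mod_add_right_eq)

lemma affine_comb_closed:
  assumes "m > 0"
  shows "affine_comb m h a t d \<in> ag_points (residue_ring m) h"
  using assms by (auto simp: affine_comb_def ag_points_def)

lemma card_ag_points_residue_ring:
  assumes "m > 0"
  shows "card (ag_points (residue_ring m) h) = nat m ^ h"
  using assms by (simp add: ag_points_def card_PiE)

lemma ag_points_Suc_restrict:
  assumes "f \<in> ag_points R (Suc h)"
  shows "restrict f {..<h} \<in> ag_points R h" "f h \<in> carrier R"
  using assms by (auto simp: ag_points_def PiE_iff)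

lemma ag_points_Suc_eqI:
  assumes "f \<in> ag_points R (Suc h)" "g \<in> ag_points R (Suc h)"
    and "restrict f {..<h} = restrict g {..<h}" "f h = g h"
  shows "f = g"
proof (rule PiE_ext)
  show "f \<in> {..<Suc h} \<rightarrow>\<^sub>E carrier R" "g \<in> {..<Suc h} \<rightarrow>\<^sub>E carrier R"
    using assms by (simp_all add: ag_points_def)
  fix i assume "i \<in> {..<Suc h}"
  then consider "i < h" | "i = h" by fastforce
  then show "f i = g i"
  proof cases
    case 1
    then show ?thesis using fun_cong[OF assms(3), of i] by simp
  qed (use assms(4) in simp)
qed

context comm_group
begin

text \<open>For \<open>p > 0\<close>, an injective homomorphism from the vectors over the integers
  modulo \<open>p\<close> into the group. Surjectivity is not built in, so that the dimension
  \<open>h\<close> can grow one element at a time.\<close>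

definition coordinates :: "nat \<Rightarrow> nat \<Rightarrow> ((nat \<Rightarrow> int) \<Rightarrow> 'a) \<Rightarrow> bool" where
  "coordinates p h c \<longleftrightarrow>
     inj_on c (ag_points (residue_ring p) h) \<and> c ` ag_points (residue_ring p) h \<subseteq> carrier G \<and>
     (\<forall>a\<in>ag_points (residue_ring p) h. \<forall>d\<in>ag_points (residue_ring p) h. \<forall>t.
        c (affine_comb p h a t d) = c a \<otimes> c d [^] t)"

lemma coordinates_zero:
  assumes "coordinates p h c" "p > 0"
  shows "c (\<lambda>i\<in>{..<h}. 0) = \<one>"
proof -
  let ?z = "\<lambda>i\<in>{..<h}. 0::int"
  have z: "?z \<in> ag_points (residue_ring p) h"
    using assms(2) by (auto simp: ag_points_def)
  have "affine_comb p h ?z 1 ?z = ?z"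
    by (auto simp: affine_comb_def)
  then have "c ?z = c ?z \<otimes> c ?z [^] (1::int)"
    using assms(1) z unfolding coordinates_def by metis
  moreover have "c ?z \<in> carrier G"
    using assms(1) z by (auto simp: coordinates_def)
  ultimately show ?thesis
    by simp
qed

lemma coordinates_subgroup:
  assumes c: "coordinates p h c" and "p > 0"
  shows "subgroup (c ` ag_points (residue_ring p) h) G"
proof -
  let ?A = "ag_points (residue_ring p) h" and ?z = "\<lambda>i\<in>{..<h}. 0::int"
  have z: "?z \<in> ?A"
    using assms(2) by (auto simp: ag_points_def)
  have sub: "c ` ?A \<subseteq> carrier G"
    and lin: "\<And>a d t. a \<in> ?A \<Longrightarrow> d \<in> ?A \<Longrightarrow> c (affine_comb p h a t d) = c a \<otimes> c d [^] t"
    using c by (auto simp: coordinates_def)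
  have mem: "c a \<otimes> c d [^] t \<in> c ` ?A" if "a \<in> ?A" "d \<in> ?A" for a d and t :: int
    using lin[OF that, of t] affine_comb_closed[of p h a t d] assms(2)
    by (metis image_eqI of_nat_0_less_iff)
  show ?thesis
  proof (rule subgroupI)
    show "c ` ?A \<subseteq> carrier G" by (fact sub)
    show "c ` ?A \<noteq> {}" using z by blast
    fix x assume "x \<in> c ` ?A"
    then obtain a where a: "a \<in> ?A" "x = c a" by blast
    have "x \<in> carrier G" using a sub by blast
    then have "inv x = c ?z \<otimes> c a [^] (- 1::int)"
      using a coordinates_zero[OF assms] by (simp add: int_pow_neg)
    then show "inv x \<in> c ` ?A"
      using mem[OF z a(1)] by simp
    fix y assume "y \<in> c ` ?A"
    then obtain b where b: "b \<in> ?A" "y = c b" by blast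
    have "y \<in> carrier G" using b sub by blast
    then show "x \<otimes> y \<in> c ` ?A"
      using mem[OF a(1) b(1), of 1] a b by simp
  qed
qed

lemma int_pow_mod_exponent:
  assumes "x \<in> carrier G" "x [^] p = \<one>"
  shows "x [^] (k mod int p) = x [^] k"
proof -
  have "x [^] k = x [^] (int p * (k div int p) + k mod int p)"
    by simp
  also have "\<dots> = (x [^] int p) [^] (k div int p) \<otimes> x [^] (k mod int p)"
    using assms(1) by (simp only: int_pow_mult int_pow_pow)
  also have "x [^] int p = \<one>"
    using assms by (simp add: int_pow_int)
  finally show ?thesis
    using assms(1) by simp
qed

text \<open>An element \<open>b\<close> outside the image becomes a new basis vector, with its
  exponent as coordinate \<open>h\<close>. Since \<open>p\<close> is prime, the powers of
  \<open>b\<close> meet the image only in the identity, which keeps the map injective.\<close>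

lemma coordinates_extend:
  assumes p: "prime p" and exponent: "\<And>x. x \<in> carrier G \<Longrightarrow> x [^] p = \<one>"
    and c: "coordinates p h c"
    and b: "b \<in> carrier G" "b \<notin> c ` ag_points (residue_ring p) h"
  shows "coordinates p (Suc h) (\<lambda>f. c (restrict f {..<h}) \<otimes> b [^] f h)"
proof -
  let ?R = "residue_ring (int p)"
  let ?A = "ag_points ?R h" and ?A' = "ag_points ?R (Suc h)"
  let ?H = "c ` ?A" and ?c = "\<lambda>f. c (restrict f {..<h}) \<otimes> b [^] f h"
  have p0: "p > 0" using p by (rule prime_gt_0_nat)
  interpret H: subgroup ?H G
    using coordinates_subgroup[OF c p0] .
  have inj: "inj_on c ?A"
    and lin: "\<And>a d t. a \<in> ?A \<Longrightarrow> d \<in> ?A \<Longrightarrow> c (affine_comb p h a t d) = c a \<otimes> c d [^] t"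
    using c by (auto simp: coordinates_def)
  have H: "c (restrict f {..<h}) \<in> ?H" if "f \<in> ?A'" for f
    using ag_points_Suc_restrict(1)[OF that] by blast
  have pow_notin: "b [^] k \<notin> ?H" if k: "\<not> int p dvd k" for k :: int
  proof
    assume bk: "b [^] k \<in> ?H"
    \<comment> \<open>\<open>k\<close> has an inverse \<open>l\<close> modulo \<open>p\<close>, so
      \<open>b\<close> would be the power \<open>(b [^] k) [^] l\<close> of an element of the
      image.\<close>
    have "coprime k (int p)"
      using p k by (metis coprime_commute prime_imp_coprime prime_nat_int_transfer)
    then obtain l where "[k * l = 1] (mod int p)"
      using cong_solve_coprime_int by blast
    then have "b [^] (k * l) = b [^] (1::int)"
      using int_pow_mod_exponent[OF b(1) exponent[OF b(1)]] unfolding cong_def by metis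
    then have "b = (b [^] k) [^] l"
      using b(1) by (simp add: int_pow_pow)
    also have "\<dots> \<in> ?H"
      using bk subgroup_int_pow_closed[OF H.subgroup_axioms] by blast
    finally show False using b(2) by blast
  qed
  have "inj_on ?c ?A'"
  proof (rule inj_onI)
    fix f g assume f: "f \<in> ?A'" and g: "g \<in> ?A'" and eq: "?c f = ?c g"
    let ?f = "restrict f {..<h}" and ?g = "restrict g {..<h}"
    have carr: "c ?f \<in> carrier G" "c ?g \<in> carrier G"
      using H[OF f] H[OF g] by auto
    \<comment> \<open>Solving for the power of \<open>b\<close> shows that it lies in the subgroup,
      so \<open>p\<close> divides the difference of the last coordinates; both lie between
      \<open>0\<close> and \<open>p - 1\<close>.\<close>
    have "b [^] (f h - g h) = inv (c ?f) \<otimes> (?c f \<otimes> inv (b [^] g h))"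
      using carr b(1) by (simp add: int_pow_diff m_assoc[symmetric])
    also have "\<dots> = inv (c ?f) \<otimes> c ?g"
      unfolding eq using carr b(1) by (simp add: m_assoc)
    also have "\<dots> \<in> ?H"
      using H[OF f] H[OF g] by simp
    finally have "int p dvd f h - g h"
      using pow_notin by blast
    moreover have "0 \<le> f h" "f h < p" "0 \<le> g h" "g h < p"
      using ag_points_Suc_restrict(2)[OF f] ag_points_Suc_restrict(2)[OF g] by auto
    ultimately have fg: "f h = g h"
      by (metis mod_eq_dvd_iff mod_pos_pos_trivial)
    then have "c ?f = c ?g"
      using eq carr b(1) by simp
    then have "?f = ?g"
      using inj ag_points_Suc_restrict(1)[OF f] ag_points_Suc_restrict(1)[OF g]
      by (auto dest: inj_onD)
    then show "f = g"
      using ag_points_Suc_eqI[OF f g] fg by blast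
  qed
  moreover have "?c ` ?A' \<subseteq> carrier G"
    using H b(1) by auto
  moreover have "?c (affine_comb p (Suc h) a t d) = ?c a \<otimes> ?c d [^] t"
    if a: "a \<in> ?A'" and d: "d \<in> ?A'" for a d t
  proof -
    let ?a = "restrict a {..<h}" and ?d = "restrict d {..<h}"
    have carr: "c ?a \<in> carrier G" "c ?d \<in> carrier G"
      using H[OF a] H[OF d] by auto
    have "restrict (affine_comb p (Suc h) a t d) {..<h} = affine_comb p h ?a t ?d"
      by (auto simp: affine_comb_def)
    moreover have "affine_comb p (Suc h) a t d h = (a h + t * d h) mod int p"
      by (simp add: affine_comb_def)
    ultimately have "?c (affine_comb p (Suc h) a t d) =
        (c ?a \<otimes> c ?d [^] t) \<otimes> (b [^] a h \<otimes> (b [^] d h) [^] t)"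
      using b(1) ag_points_Suc_restrict(1)[OF a] ag_points_Suc_restrict(1)[OF d]
      by (simp add: lin int_pow_mod_exponent exponent int_pow_mult int_pow_pow mult.commute)
    also have "\<dots> = ?c a \<otimes> ?c d [^] t"
      using carr b(1) by (simp add: int_pow_distrib m_ac)
    finally show ?thesis .
  qed
  ultimately show ?thesis
    unfolding coordinates_def by blast
qed

text \<open>A largest independent family is a basis: an element missed by the image would extend the
  coordinates, against the maximality of \<open>h\<close>.\<close>

lemma elementary_abelian_coordinates:
  assumes p: "prime p" and exponent: "\<And>x. x \<in> carrier G \<Longrightarrow> x [^] p = \<one>"
    and fin: "finite (carrier G)"
  obtains h c where "coordinates p h c" "c ` ag_points (residue_ring p) h = carrier G"
proof -
  have p1: "p > 1" using p by (rule prime_gt_1_nat)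
  let ?P = "\<lambda>h. \<exists>c. coordinates p h c"
  \<comment> \<open>In dimension 0 the only vector is the function that is undefined everywhere, so
    a constant map is injective.\<close>
  have ex0: "?P 0"
    by (rule exI[of _ "\<lambda>_. \<one>"]) (auto simp: coordinates_def ag_points_def)
  \<comment> \<open>Injectivity gives \<open>p ^ h \<le> card (carrier G)\<close>; the cruder bound
    on \<open>h\<close> itself is what makes a greatest \<open>h\<close> exist.\<close>
  have bound: "h \<le> card (carrier G)" if ex: "\<exists>c. coordinates p h c" for h
  proof -
    obtain c where "inj_on c (ag_points (residue_ring p) h)"
        "c ` ag_points (residue_ring p) h \<subseteq> carrier G"
      using ex unfolding coordinates_def by blast
    then have "card (ag_points (residue_ring p) h) \<le> card (carrier G)"
      using fin by (rule card_inj_on_le)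
    then have "p ^ h \<le> card (carrier G)"
      using p1 by (simp add: card_ag_points_residue_ring)
    moreover have "h < p ^ h"
      using p1 by (simp add: power_gt_expt)
    ultimately show ?thesis by simp
  qed
  obtain h where h: "?P h" and max: "\<And>h'. ?P h' \<Longrightarrow> h' \<le> h"
    using GreatestI_nat[of ?P, OF ex0 bound] Greatest_le_nat[of ?P, OF _ bound] by blast
  obtain c where c: "coordinates p h c" using h by blast
  have "c ` ag_points (residue_ring p) h = carrier G"
  proof (rule ccontr)
    assume "c ` ag_points (residue_ring p) h \<noteq> carrier G"
    moreover have "c ` ag_points (residue_ring p) h \<subseteq> carrier G"
      using c by (simp add: coordinates_def)
    ultimately obtain b where "b \<in> carrier G" "b \<notin> c ` ag_points (residue_ring p) h"
      by blast
    then have "?P (Suc h)"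
      using coordinates_extend[OF p exponent c] by blast
    then have "Suc h \<le> h" by (rule max)
    then show False by simp
  qed
  with c show ?thesis by (rule that)
qed

end

section \<open>Stabilizers of pairs and a fixed point of a 2-subgroup\<close>

context group_action
begin

text \<open>\<open>Z\<close> is a union of orbits, whose sizes divide \<open>p ^ n\<close>. If
  \<open>p\<close> divided all of them, it would divide \<open>card Z\<close>; hence some orbit has
  size 1.\<close>

lemma p_group_fixed_point:
  assumes p: "prime p" and ord: "order G = p ^ n"
    and fin: "finite Z" and Z: "Z \<subseteq> E"
    and inv: "\<And>g z. g \<in> carrier G \<Longrightarrow> z \<in> Z \<Longrightarrow> \<phi> g z \<in> Z"
    and ndvd: "\<not> p dvd card Z"
  obtains z where "z \<in> Z" "\<And>g. g \<in> carrier G \<Longrightarrow> \<phi> g z = z"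
proof -
  let ?C = "orbit G \<phi> ` Z"
  have sub: "orbit G \<phi> z \<subseteq> Z" if "z \<in> Z" for z
    using inv that by (auto simp: orbit_def)
  have self: "z \<in> orbit G \<phi> z" if "z \<in> Z" for z
    using orbit_refl Z that by blast
  have Union: "\<Union>?C = Z"
    using sub self by blast
  have disj: "c1 \<inter> c2 = {}" if "c1 \<in> ?C" "c2 \<in> ?C" "c1 \<noteq> c2" for c1 c2
  proof -
    have "c1 \<in> orbits G E \<phi>" "c2 \<in> orbits G E \<phi>"
      using that Z by (auto simp: orbits_def)
    then show ?thesis using disjoint_union that(3) by blast
  qed
  have "\<exists>z\<in>Z. \<not> p dvd card (orbit G \<phi> z)"
  proof (rule ccontr)
    assume *: "\<not> ?thesis"
    have "p dvd card (\<Union>?C)"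
    proof (rule dvd_partition)
      show "finite (\<Union>?C)" using Union fin by simp
      show "\<forall>c\<in>?C. p dvd card c" using * by blast
      show "\<forall>c1\<in>?C. \<forall>c2\<in>?C. c1 \<noteq> c2 \<longrightarrow> c1 \<inter> c2 = {}" using disj by blast
    qed
    then show False using Union ndvd by simp
  qed
  then obtain z where z: "z \<in> Z" "\<not> p dvd card (orbit G \<phi> z)" by blast
  have "card (orbit G \<phi> z) dvd p ^ n"
    using orbit_stabilizer_theorem[of z] z(1) Z ord by (metis dvd_triv_left subsetD)
  then obtain k where "card (orbit G \<phi> z) = p ^ k"
    using p divides_primepow_nat by blast
  then have "card (orbit G \<phi> z) = 1"
    using z(2) by (cases k) auto
  then have "orbit G \<phi> z = {z}"
    using self[OF z(1)] by (metis card_1_singletonE singletonD)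
  then have "\<phi> g z = z" if "g \<in> carrier G" for g
    using that by (auto simp: orbit_def)
  with z(1) show ?thesis by (rule that)
qed

lemma action_closed: "g \<in> carrier G \<Longrightarrow> x \<in> E \<Longrightarrow> \<phi> g x \<in> E"
  using element_image by blast

lemma action_one: "x \<in> E \<Longrightarrow> \<phi> \<one> x = x"
  by (metis id_eq_one restrict_apply')

lemma action_inj: "g \<in> carrier G \<Longrightarrow> x \<in> E \<Longrightarrow> y \<in> E \<Longrightarrow> \<phi> g x = \<phi> g y \<longleftrightarrow> x = y"
  using inj_prop by (auto dest: inj_onD)

definition pointwise_stabilizer :: "'c \<Rightarrow> 'c \<Rightarrow> 'a set" where
  "pointwise_stabilizer x y = {g \<in> carrier G. \<phi> g x = x \<and> \<phi> g y = y}"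

definition setwise_stabilizer :: "'c \<Rightarrow> 'c \<Rightarrow> 'a set" where
  "setwise_stabilizer x y = {g \<in> carrier G. \<phi> g ` {x, y} = {x, y}}"

lemma setwise_stabilizer_iff:
  "g \<in> setwise_stabilizer x y \<longleftrightarrow>
     g \<in> carrier G \<and> (\<phi> g x = x \<and> \<phi> g y = y \<or> \<phi> g x = y \<and> \<phi> g y = x)"
  by (auto simp: setwise_stabilizer_def doubleton_eq_iff)

lemma pointwise_stabilizer_subgroup:
  assumes "x \<in> E" "y \<in> E"
  shows "subgroup (pointwise_stabilizer x y) G"
proof -
  interpret group G using group_hom by (rule group_hom.axioms(1))
  have "subgroup (stabilizer G \<phi> x \<inter> stabilizer G \<phi> y) G"
    using stabilizer_subgroup assms by (intro subgroups_Inter_pair)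
  also have "stabilizer G \<phi> x \<inter> stabilizer G \<phi> y = pointwise_stabilizer x y"
    by (auto simp: stabilizer_def pointwise_stabilizer_def)
  finally show ?thesis .
qed

lemma setwise_stabilizer_subgroup:
  assumes "x \<in> E" "y \<in> E"
  shows "subgroup (setwise_stabilizer x y) G"
proof -
  interpret group G using group_hom by (rule group_hom.axioms(1))
  show ?thesis
  proof (rule subgroupI)
    show "setwise_stabilizer x y \<subseteq> carrier G"
      by (auto simp: setwise_stabilizer_def)
    have "\<one> \<in> setwise_stabilizer x y"
      using assms by (simp add: setwise_stabilizer_iff action_one)
    then show "setwise_stabilizer x y \<noteq> {}" by blast
  next
    fix g assume g: "g \<in> setwise_stabilizer x y"
    then have "\<phi> (inv g) (\<phi> g x) = x" "\<phi> (inv g) (\<phi> g y) = y"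
      using assms by (simp_all add: setwise_stabilizer_iff orbit_sym_aux)
    with g show "inv g \<in> setwise_stabilizer x y"
      by (auto simp: setwise_stabilizer_iff)
  next
    fix g h assume "g \<in> setwise_stabilizer x y" "h \<in> setwise_stabilizer x y"
    then show "g \<otimes> h \<in> setwise_stabilizer x y"
      using assms by (fastforce simp: setwise_stabilizer_iff composition_rule)
  qed
qed

text \<open>Conjugation by \<open>h\<close> carries one stabilizer onto the other. Together with
  2-transitivity this gives all stabilizers of two distinct points the same order.\<close>

lemma card_pointwise_stabilizer_conj:
  assumes h: "h \<in> carrier G" and "x \<in> E" "y \<in> E"
  shows "card (pointwise_stabilizer (\<phi> h x) (\<phi> h y)) = card (pointwise_stabilizer x y)"
proof -
  interpret group G using group_hom by (rule group_hom.axioms(1))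
  have cancel: "inv h \<otimes> (h \<otimes> k) = k" "h \<otimes> (inv h \<otimes> k) = k" if "k \<in> carrier G" for k
    using h that by (simp_all flip: m_assoc)
  have "bij_betw (\<lambda>g. h \<otimes> g \<otimes> inv h) (pointwise_stabilizer x y)
          (pointwise_stabilizer (\<phi> h x) (\<phi> h y))"
  proof (rule bij_betw_byWitness[where f' = "\<lambda>g. inv h \<otimes> g \<otimes> h"])
    show "\<forall>g\<in>pointwise_stabilizer x y. inv h \<otimes> (h \<otimes> g \<otimes> inv h) \<otimes> h = g"
      using h by (auto simp: pointwise_stabilizer_def m_assoc cancel)
    show "\<forall>g\<in>pointwise_stabilizer (\<phi> h x) (\<phi> h y). h \<otimes> (inv h \<otimes> g \<otimes> h) \<otimes> inv h = g"
      using h by (auto simp: pointwise_stabilizer_def m_assoc cancel)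
    show "(\<lambda>g. h \<otimes> g \<otimes> inv h) ` pointwise_stabilizer x y
            \<subseteq> pointwise_stabilizer (\<phi> h x) (\<phi> h y)"
      using assms orbit_sym_aux[OF h]
      by (auto simp: pointwise_stabilizer_def composition_rule action_closed)
    show "(\<lambda>g. inv h \<otimes> g \<otimes> h) ` pointwise_stabilizer (\<phi> h x) (\<phi> h y)
            \<subseteq> pointwise_stabilizer x y"
      using assms orbit_sym_aux[OF h]
      by (auto simp: pointwise_stabilizer_def composition_rule action_closed)
  qed
  then show ?thesis by (metis bij_betw_same_card)
qed

text \<open>The swap \<open>s\<close> represents the second coset: any element exchanging
  \<open>x\<close> and \<open>y\<close> is \<open>s\<close> times an element fixing both.\<close>

lemma card_setwise_stabilizer:
  assumes fin: "finite (carrier G)" and xy: "x \<in> E" "y \<in> E" "x \<noteq> y"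
    and s: "s \<in> carrier G" "\<phi> s x = y" "\<phi> s y = x"
  shows "card (setwise_stabilizer x y) = 2 * card (pointwise_stabilizer x y)"
proof -
  interpret group G using group_hom by (rule group_hom.axioms(1))
  let ?K = "pointwise_stabilizer x y"
  have K: "?K \<subseteq> carrier G" by (auto simp: pointwise_stabilizer_def)
  have "setwise_stabilizer x y = ?K \<union> (\<otimes>) s ` ?K"
  proof (intro Set.set_eqI iffI)
    fix g assume "g \<in> setwise_stabilizer x y"
    then consider "g \<in> ?K" | "g \<in> carrier G" "\<phi> g x = y" "\<phi> g y = x"
      by (auto simp: setwise_stabilizer_iff pointwise_stabilizer_def)
    then show "g \<in> ?K \<union> (\<otimes>) s ` ?K"
    proof cases
      case 2
      have "\<phi> (inv s) y = x" "\<phi> (inv s) x = y"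
        using s xy by (simp_all add: orbit_sym_aux)
      then have "inv s \<otimes> g \<in> ?K"
        using 2 s xy by (simp add: pointwise_stabilizer_def composition_rule)
      moreover have "g = s \<otimes> (inv s \<otimes> g)"
        using 2 s by (simp flip: m_assoc)
      ultimately show ?thesis by blast
    qed blast
  qed (use s xy in \<open>auto simp: setwise_stabilizer_iff pointwise_stabilizer_def composition_rule\<close>)
  moreover have "?K \<inter> (\<otimes>) s ` ?K = {}"
    using s xy by (auto simp: pointwise_stabilizer_def composition_rule)
  moreover have "card ((\<otimes>) s ` ?K) = card ?K"
    using inj_on_subset[OF inj_on_cmult[OF s(1)] K] by (rule card_image)
  ultimately show ?thesis
    using fin K by (simp add: card_Un_disjoint finite_subset)
qed

text \<open>\<open>Z\<close> will be the set of third points of the blocks through \<open>x\<close>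
  and \<open>y\<close>. The last conclusion keeps \<open>T\<close> from fixing two distinct points
  once all two-point stabilizers have the same order.\<close>

lemma two_subgroup_fixing_point:
  assumes fin: "finite (carrier G)" and xy: "x \<in> E" "y \<in> E" "x \<noteq> y"
    and s: "s \<in> carrier G" "\<phi> s x = y" "\<phi> s y = x"
    and Z: "Z \<subseteq> E" "odd (card Z)"
    and inv: "\<And>g z. g \<in> setwise_stabilizer x y \<Longrightarrow> z \<in> Z \<Longrightarrow> \<phi> g z \<in> Z"
  obtains T z where "subgroup T G" "T \<subseteq> setwise_stabilizer x y" "z \<in> Z"
    "\<And>g. g \<in> T \<Longrightarrow> \<phi> g z = z" "\<not> card T dvd card (pointwise_stabilizer x y)"
proof -
  interpret group G using group_hom by (rule group_hom.axioms(1))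
  let ?K = "pointwise_stabilizer x y" and ?M = "setwise_stabilizer x y"
  interpret M: subgroup ?M G using setwise_stabilizer_subgroup[OF xy(1,2)] .
  have K0: "card ?K \<noteq> 0"
    using subgroup.finite_imp_card_positive[OF pointwise_stabilizer_subgroup[OF xy(1,2)] fin]
    by simp
  \<comment> \<open>The exponent of 2 in \<open>card ?M\<close>, which is twice
    \<open>card ?K\<close>. So \<open>2 ^ n\<close> divides the first order but not the second,
    \<open>card ?K\<close> being nonzero.\<close>
  define n where "n = Suc (multiplicity 2 (card ?K))"
  have "(2::nat) ^ multiplicity 2 (card ?K) dvd card ?K"
    by (rule multiplicity_dvd)
  then have "2 ^ n dvd card ?M"
    unfolding n_def card_setwise_stabilizer[OF fin xy s] by simp
  then obtain m where m: "card ?M = 2 ^ n * m" by blast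
  have "\<exists>T. subgroup T (G\<lparr>carrier := ?M\<rparr>) \<and> card T = 2 ^ n"
  proof (rule sylow_thm)
    show "group (G\<lparr>carrier := ?M\<rparr>)" by (rule M.subgroup_is_group) (rule group_axioms)
    show "order (G\<lparr>carrier := ?M\<rparr>) = 2 ^ n * m" using m by (simp add: order_def)
    show "finite (carrier (G\<lparr>carrier := ?M\<rparr>))"
      using fin M.subset by (simp add: finite_subset)
  qed simp
  then obtain T where T: "subgroup T (G\<lparr>carrier := ?M\<rparr>)" "card T = 2 ^ n" by blast
  have TG: "subgroup T G"
    using incl_subgroup[OF M.subgroup_axioms T(1)] .
  have TM: "T \<subseteq> ?M"
    using subgroup.subset[OF T(1)] by simp
  interpret T: group_action "G\<lparr>carrier := T\<rparr>" E \<phi>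
    using induced_action[OF TG] .
  have "\<not> card T dvd card ?K"
    using K0 power_dvd_iff_le_multiplicity[of "card ?K" 2 n] unfolding T(2) n_def by simp
  moreover obtain z where "z \<in> Z" "\<And>g. g \<in> carrier (G\<lparr>carrier := T\<rparr>) \<Longrightarrow> \<phi> g z = z"
  proof (rule T.p_group_fixed_point[of 2 n Z])
    show "order (G\<lparr>carrier := T\<rparr>) = 2 ^ n" using T(2) by (simp add: order_def)
    show "finite Z" using Z(2) card.infinite by fastforce
  qed (use Z inv TM in auto)
  ultimately show ?thesis
    using that TG TM by simp
qed

end

section \<open>Triple systems with an affine 2-transitive group\<close>

text \<open>\<open>N\<close> is the translation group, written multiplicatively: each point is
  \<open>\<phi> n z\<close> for a unique position vector \<open>n\<close> relative to an origin
  \<open>z\<close>. That cubes in \<open>N\<close> are trivial is derived later from the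
  blocks.\<close>

locale two_transitive_affine_action = group_action +
  fixes N
  assumes finite_carrier: "finite (carrier G)"
    and two_transitive: "\<lbrakk>x \<in> E; y \<in> E; x' \<in> E; y' \<in> E; x \<noteq> y; x' \<noteq> y'\<rbrakk>
      \<Longrightarrow> \<exists>g\<in>carrier G. \<phi> g x = x' \<and> \<phi> g y = y'"
    and N_normal: "N \<lhd> G"
    and N_comm: "\<lbrakk>m \<in> N; n \<in> N\<rbrakk> \<Longrightarrow> m \<otimes> n = n \<otimes> m"
    and N_regular: "\<lbrakk>x \<in> E; y \<in> E\<rbrakk> \<Longrightarrow> \<exists>!n. n \<in> N \<and> \<phi> n x = y"
begin

sublocale group G
  using group_hom by (rule group_hom.axioms(1))

sublocale N: normal N G
  by (rule N_normal)

lemma N_eqI: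
  assumes "m \<in> N" "n \<in> N" "x \<in> E" "\<phi> m x = \<phi> n x"
  shows "m = n"
  using N_regular[OF assms(3) action_closed[OF N.mem_carrier[OF assms(2)] assms(3)]] assms by blast

lemma N_eq_oneI:
  assumes "n \<in> N" "x \<in> E" "\<phi> n x = x"
  shows "n = \<one>"
  using N_eqI[of n \<one> x] assms by (simp add: action_one)

lemma N_conj:
  assumes "g \<in> carrier G" "n \<in> N"
  shows "g \<otimes> n \<otimes> inv g \<in> N"
  using N.inv_op_closed2 assms by blast

text \<open>Conjugation acts on translations as the linear part of \<open>g\<close>: when
  \<open>g\<close> fixes the origin, it moves position vectors the way \<open>g\<close> moves
  points.\<close>

lemma N_conj_action:
  assumes "g \<in> carrier G" "n \<in> N" "x \<in> E"
  shows "\<phi> (g \<otimes> n \<otimes> inv g) (\<phi> g x) = \<phi> g (\<phi> n x)"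
  using assms orbit_sym_aux[of g x "\<phi> g x"]
  by (simp add: composition_rule action_closed N.mem_carrier)

lemma card_pointwise_stabilizer_eq:
  assumes "x \<in> E" "y \<in> E" "x' \<in> E" "y' \<in> E" "x \<noteq> y" "x' \<noteq> y'"
  shows "card (pointwise_stabilizer x' y') = card (pointwise_stabilizer x y)"
proof -
  obtain g where "g \<in> carrier G" "\<phi> g x = x'" "\<phi> g y = y'"
    using two_transitive[OF assms] by blast
  then show ?thesis
    using card_pointwise_stabilizer_conj[of g x y] assms(1,2) by simp
qed

text \<open>
  With \<open>z\<close> as the origin, \<open>N\<close> is the space of position vectors and \<open>m \<otimes> n\<close> is the sum of \<open>x\<close> and \<open>y\<close>.
\<close>

lemma midpoint_if_fixed:
  assumes T: "subgroup T G" "T \<subseteq> setwise_stabilizer x y"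
    and fixed: "\<And>g. g \<in> T \<Longrightarrow> \<phi> g z = z"
    and ndvd: "\<not> card T dvd card (pointwise_stabilizer x y)"
    and E: "x \<in> E" "y \<in> E" "x \<noteq> y" "z \<in> E"
    and mn: "m \<in> N" "n \<in> N" "\<phi> m z = x" "\<phi> n z = y"
  shows "m \<otimes> n = \<one>"
proof -
  interpret T: subgroup T G by (fact T(1))
  let ?u = "m \<otimes> n"
  have u: "?u \<in> N" using mn by simp
  have commute: "\<phi> g (\<phi> ?u z) = \<phi> ?u z" if g: "g \<in> T" for g
  proof -
    have gG: "g \<in> carrier G" using g T.subset by blast
    have conj: "g \<otimes> k \<otimes> inv g \<in> N" "\<phi> (g \<otimes> k \<otimes> inv g) z = \<phi> g (\<phi> k z)" if "k \<in> N" for k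
      using N_conj[OF gG that] N_conj_action[OF gG that E(4)] fixed[OF g] by simp_all
    have cancel: "inv g \<otimes> (g \<otimes> k) = k" if "k \<in> carrier G" for k
      using gG that by (simp flip: m_assoc)
    \<comment> \<open>\<open>g\<close> fixes the origin \<open>z\<close>, so conjugation moves the
      position vectors \<open>m\<close>, \<open>n\<close> as \<open>g\<close> moves
      \<open>x\<close>, \<open>y\<close>: it fixes both or swaps them. Commutativity of
      \<open>N\<close> then makes the product invariant.\<close>
    have "g \<otimes> m \<otimes> inv g = m \<and> g \<otimes> n \<otimes> inv g = n \<or> g \<otimes> m \<otimes> inv g = n \<and> g \<otimes> n \<otimes> inv g = m"
    proof -
      have "\<phi> g x = x \<and> \<phi> g y = y \<or> \<phi> g x = y \<and> \<phi> g y = x"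
        using g T(2) by (auto simp: setwise_stabilizer_iff)
      then show ?thesis
        using conj[OF mn(1)] conj[OF mn(2)] mn N_eqI E(4) by metis
    qed
    moreover have "g \<otimes> ?u \<otimes> inv g = (g \<otimes> m \<otimes> inv g) \<otimes> (g \<otimes> n \<otimes> inv g)"
      using gG mn by (simp add: m_assoc N.mem_carrier cancel)
    ultimately have "g \<otimes> ?u \<otimes> inv g = ?u"
      using N_comm[OF mn(1,2)] by auto
    then show ?thesis using conj(2)[OF u] by simp
  qed
  have "\<phi> ?u z = z"
  proof (rule ccontr)
    assume ne: "\<phi> ?u z \<noteq> z"
    have w: "\<phi> ?u z \<in> E" using u E(4) action_closed N.mem_carrier by blast
    let ?S = "pointwise_stabilizer z (\<phi> ?u z)"
    have S: "subgroup ?S G" using pointwise_stabilizer_subgroup[OF E(4) w] .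
    have "T \<subseteq> ?S"
      using fixed commute T.subset by (auto simp: pointwise_stabilizer_def)
    then have "subgroup T (G\<lparr>carrier := ?S\<rparr>)"
      using subgroup_incl T(1) S by blast
    then have "card T dvd order (G\<lparr>carrier := ?S\<rparr>)"
      using group.lagrange[OF subgroup.subgroup_is_group[OF S group_axioms]]
        dvd_triv_right[of "card T"] by metis
    also have "order (G\<lparr>carrier := ?S\<rparr>) = card ?S" by (simp add: order_def)
    also have "card ?S = card (pointwise_stabilizer x y)"
      using card_pointwise_stabilizer_eq[of x y z "\<phi> ?u z"] E w ne by simp
    finally show False using ndvd by simp
  qed
  then show ?thesis using N_eq_oneI u E(4) by blast
qed

text \<open>Third points of the pair correspond one to one to its blocks, so their number is odd and
  the 2-subgroup fixes one of them, \<open>z\<close>. Additively, \<open>x\<close> is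
  \<open>z\<close> plus \<open>n\<close> and \<open>y\<close> is \<open>z\<close> minus
  \<open>n\<close>, which expresses the midpoint without dividing by 2.\<close>

lemma midpoint_block:
  assumes blocks: "\<And>B. B \<in> \<B> \<Longrightarrow> B \<subseteq> E \<and> card B = 3"
    and odd: "\<And>x y. x \<in> E \<Longrightarrow> y \<in> E \<Longrightarrow> x \<noteq> y \<Longrightarrow> odd (card {B \<in> \<B>. x \<in> B \<and> y \<in> B})"
    and inv: "\<And>g B. g \<in> carrier G \<Longrightarrow> B \<in> \<B> \<Longrightarrow> \<phi> g ` B \<in> \<B>"
    and xy: "x \<in> E" "y \<in> E" "x \<noteq> y"
  obtains z n where "z \<in> E" "n \<in> N" "\<phi> n z = x" "\<phi> (inv n) z = y" "{x, y, z} \<in> \<B>"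
proof -
  let ?Z = "{z. {x, y, z} \<in> \<B>}"
  \<comment> \<open>A coincidence among the three points would leave fewer than three elements in
    the block.\<close>
  have ne: "z \<noteq> x \<and> z \<noteq> y \<and> z \<in> E" if "{x, y, z} \<in> \<B>" for z
    using blocks[OF that] by (auto simp: card_insert_if split: if_splits)
  have "bij_betw (\<lambda>z. {x, y, z}) ?Z {B \<in> \<B>. x \<in> B \<and> y \<in> B}"
  proof (rule bij_betw_imageI)
    show "inj_on (\<lambda>z. {x, y, z}) ?Z"
      using ne by (auto intro!: inj_onI)
    show "(\<lambda>z. {x, y, z}) ` ?Z = {B \<in> \<B>. x \<in> B \<and> y \<in> B}"
    proof (intro subset_antisym subsetI)
      fix B assume B: "B \<in> {B \<in> \<B>. x \<in> B \<and> y \<in> B}"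
      then have "card (B - {x, y}) = 1"
        using blocks[of B] xy(3) by (simp add: card_Diff_subset)
      then obtain z where "B - {x, y} = {z}" by (rule card_1_singletonE)
      then have "B = {x, y, z}" using B by blast
      then show "B \<in> (\<lambda>z. {x, y, z}) ` ?Z" using B by blast
    qed auto
  qed
  then have "odd (card ?Z)"
    using odd[OF xy] by (simp add: bij_betw_same_card)
  moreover have "?Z \<subseteq> E" using ne by blast
  moreover have "\<phi> g z \<in> ?Z" if "g \<in> setwise_stabilizer x y" "z \<in> ?Z" for g z
  proof -
    have "g \<in> carrier G" "\<phi> g ` {x, y} = {x, y}"
      using that(1) by (simp_all add: setwise_stabilizer_def)
    then have "\<phi> g ` {x, y, z} = {x, y, \<phi> g z}" by auto
    then show ?thesis
      using inv[of g "{x, y, z}"] that(2) \<open>g \<in> carrier G\<close> by simp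
  qed
  moreover obtain s where "s \<in> carrier G" "\<phi> s x = y" "\<phi> s y = x"
    using two_transitive[of x y y x] xy by blast
  ultimately obtain T z where T: "subgroup T G" "T \<subseteq> setwise_stabilizer x y"
    and z: "z \<in> ?Z" and fixed: "\<And>g. g \<in> T \<Longrightarrow> \<phi> g z = z"
    and ndvd: "\<not> card T dvd card (pointwise_stabilizer x y)"
    using two_subgroup_fixing_point[OF finite_carrier xy, of _ ?Z] by metis
  have zE: "z \<in> E" and zB: "{x, y, z} \<in> \<B>" using z ne by auto
  obtain m n where mn: "m \<in> N" "n \<in> N" "\<phi> m z = x" "\<phi> n z = y"
    using N_regular[OF zE xy(1)] N_regular[OF zE xy(2)] by blast
  have "m \<otimes> n = \<one>"
    using midpoint_if_fixed[OF T fixed ndvd xy zE mn] .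
  then have "inv m = n"
    using mn(1,2) N_comm inv_equality by (metis N.mem_carrier)
  then show ?thesis using that zE zB mn by metis
qed

text \<open>A block with midpoint \<open>z\<close> consists of \<open>z\<close>,
  \<open>\<phi> n z\<close> and \<open>\<phi> (inv n) z\<close>. A symmetry of it moving
  \<open>z\<close> to \<open>x\<close> makes \<open>x\<close> a midpoint too, which forces the cube
  of \<open>n\<close> to be trivial; 2-transitivity carries this to all of \<open>N\<close>.\<close>

theorem triple_system_blocks:
  assumes blocks: "\<And>B. B \<in> \<B> \<Longrightarrow> B \<subseteq> E \<and> card B = 3"
    and odd: "\<And>x y. x \<in> E \<Longrightarrow> y \<in> E \<Longrightarrow> x \<noteq> y \<Longrightarrow> odd (card {B \<in> \<B>. x \<in> B \<and> y \<in> B})"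
    and inv: "\<And>g B. g \<in> carrier G \<Longrightarrow> B \<in> \<B> \<Longrightarrow> \<phi> g ` B \<in> \<B>"
    and flag: "\<And>B C x y. B \<in> \<B> \<Longrightarrow> C \<in> \<B> \<Longrightarrow> x \<in> B \<Longrightarrow> y \<in> C \<Longrightarrow>
      \<exists>g\<in>carrier G. \<phi> g x = y \<and> \<phi> g ` B = C"
    and E: "\<exists>x\<in>E. \<exists>y\<in>E. x \<noteq> y"
  shows "\<And>n. n \<in> N \<Longrightarrow> n [^] (3::nat) = \<one>"
    and "\<B> = {{w, \<phi> n w, \<phi> (n \<otimes> n) w} | w n. w \<in> E \<and> n \<in> N \<and> n \<noteq> \<one>}"
proof -
  have pow3: "n [^] (3::nat) = n \<otimes> n \<otimes> n" if "n \<in> N" for n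
    using that N.mem_carrier by (simp add: numeral_3_eq_3 m_assoc)
  have mid: "\<exists>z n. z \<in> E \<and> n \<in> N \<and> \<phi> n z = x \<and> \<phi> (inv n) z = y \<and> {x, y, z} \<in> \<B>"
    if "x \<in> E" "y \<in> E" "x \<noteq> y" for x y
    by (rule midpoint_block[of \<B> x y]) (use blocks odd inv that in blast)+
  obtain x y where xy: "x \<in> E" "y \<in> E" "x \<noteq> y" using E by blast
  obtain z n where z: "z \<in> E" and n: "n \<in> N" and nz: "\<phi> n z = x" "\<phi> (inv n) z = y"
    and B: "{x, y, z} \<in> \<B>"
    using mid[OF xy] by metis
  have ninv: "inv n \<in> N" using n by simp
  have n1: "n \<noteq> \<one>" using nz xy z by (auto simp: action_one)
  obtain g where g: "g \<in> carrier G" "\<phi> g z = x" "\<phi> g ` {x, y, z} = {x, y, z}"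
    using flag[OF B B, of z x] by blast
  \<comment> \<open>The translation that exhibits \<open>x\<close> as the midpoint of
    \<open>\<phi> g x\<close> and \<open>\<phi> g y\<close>.\<close>
  define m where "m = g \<otimes> n \<otimes> inv g"
  have m: "m \<in> N" unfolding m_def using N_conj g n by blast
  have minv: "inv m = g \<otimes> inv n \<otimes> inv g"
    unfolding m_def using g n by (simp add: inv_mult_group m_assoc N.mem_carrier)
  have mx: "\<phi> m x = \<phi> g x" "\<phi> (inv m) x = \<phi> g y"
    unfolding minv unfolding m_def
    using N_conj_action[OF g(1) n z] N_conj_action[OF g(1) ninv z] g(2) nz by simp_all
  have gxy: "\<phi> g x = y \<and> \<phi> g y = z \<or> \<phi> g x = z \<and> \<phi> g y = y"
  proof -
    have "z \<noteq> x" "z \<noteq> y" using blocks[OF B] by (auto simp: card_insert_if split: if_splits)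
    have "\<phi> g x \<noteq> \<phi> g y" "\<phi> g x \<noteq> x" "\<phi> g y \<noteq> x"
      using \<open>z \<noteq> x\<close> \<open>z \<noteq> y\<close> xy z g(1) unfolding g(2)[symmetric]
      by (simp_all add: action_inj)
    moreover have "\<phi> g x \<in> {x, y, z}" "\<phi> g y \<in> {x, y, z}"
      using g(3) by blast+
    ultimately show ?thesis by (metis insertE singletonD)
  qed
  \<comment> \<open>The steps from \<open>x\<close> to the other two points are \<open>m\<close> and
    \<open>inv m\<close>; the steps from \<open>z\<close> are \<open>n\<close> and
    \<open>inv n\<close>. Comparing them gives \<open>m = n\<close> in the first case and
    \<open>inv m = n\<close> in the second.\<close>
  have "n \<otimes> n = inv n"
    using gxy
  proof
    assume "\<phi> g x = y \<and> \<phi> g y = z"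
    then have "\<phi> (m \<otimes> n) z = \<phi> (inv n) z" "\<phi> (inv m \<otimes> n) z = z"
      using mx nz m n z by (simp_all add: composition_rule N.mem_carrier)
    then have "m \<otimes> n = inv n" "inv m \<otimes> n = \<one>"
      using m n z N_eqI[of "m \<otimes> n" "inv n" z] N_eq_oneI[of "inv m \<otimes> n" z] by simp_all
    moreover from this(2) have "n = m"
      using m n by (metis N.mem_carrier inv_closed inv_comm inv_equality inv_inv)
    ultimately show ?thesis by simp
  next
    assume "\<phi> g x = z \<and> \<phi> g y = y"
    then have "\<phi> (m \<otimes> n) z = z" "\<phi> (inv m \<otimes> n) z = \<phi> (inv n) z"
      using mx nz m n z by (simp_all add: composition_rule N.mem_carrier)
    then have "inv m \<otimes> n = inv n" "m \<otimes> n = \<one>"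
      using m n z N_eqI[of "inv m \<otimes> n" "inv n" z] N_eq_oneI[of "m \<otimes> n" z] by simp_all
    moreover from this(2) have "inv m = n"
      using m n by (metis N.mem_carrier inv_comm inv_equality)
    ultimately show ?thesis by simp
  qed
  then have n3: "n \<otimes> n \<otimes> n = \<one>"
    using n by (simp add: N.mem_carrier)
  have cube: "k \<otimes> k \<otimes> k = \<one>" if k: "k \<in> N" for k
  proof (cases "k = \<one>")
    case False
    \<comment> \<open>The stabilizer of \<open>z\<close> is transitive on the other points, so every
      nonidentity \<open>k\<close> is a conjugate of \<open>n\<close> and inherits its trivial
      cube.\<close>
    have "\<phi> k z \<noteq> z" "\<phi> n z \<noteq> z" using False n1 N_eq_oneI k n z by blast+
    moreover have "\<phi> k z \<in> E" "\<phi> n z \<in> E"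
      using k n z action_closed N.mem_carrier by blast+
    ultimately obtain h where h: "h \<in> carrier G" "\<phi> h z = z" "\<phi> h (\<phi> n z) = \<phi> k z"
      using two_transitive[of z "\<phi> n z" z "\<phi> k z"] z by metis
    have "h \<otimes> n \<otimes> inv h = k"
      using N_eqI[OF N_conj[OF h(1) n] k z] N_conj_action[OF h(1) n z] h by simp
    moreover have "inv h \<otimes> (h \<otimes> l) = l" if "l \<in> carrier G" for l
      using h(1) that by (simp flip: m_assoc)
    ultimately have "k \<otimes> k \<otimes> k = h \<otimes> (n \<otimes> n \<otimes> n) \<otimes> inv h"
      using h(1) n by (auto simp: m_assoc N.mem_carrier)
    then show ?thesis using n3 h(1) by simp
  qed simp
  show "n [^] (3::nat) = \<one>" if "n \<in> N" for n
    using cube pow3 that by simp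
  have inv2: "inv k = k \<otimes> k" if "k \<in> N" for k
    using cube[OF that] that by (intro inv_equality) (simp_all add: N.mem_carrier)
  show "\<B> = {{w, \<phi> n w, \<phi> (n \<otimes> n) w} | w n. w \<in> E \<and> n \<in> N \<and> n \<noteq> \<one>}"
  proof (intro subset_antisym subsetI)
    fix C assume C: "C \<in> \<B>"
    then have "C \<noteq> {}" using blocks[OF C] by auto
    then obtain w where "w \<in> C" by blast
    then obtain h where h: "h \<in> carrier G" "\<phi> h ` {x, y, z} = C"
      using flag[OF B C, of x w] by blast
    let ?k = "h \<otimes> n \<otimes> inv h"
    have k: "?k \<in> N" using N_conj h n by blast
    \<comment> \<open>Since cubes are trivial, \<open>?k \<otimes> ?k\<close> is the inverse of
      \<open>?k\<close>; this gives the image of \<open>y\<close>, the translate of \<open>z\<close>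
      by \<open>inv n\<close>, the required form.\<close>
    have kinv: "?k \<otimes> ?k = h \<otimes> inv n \<otimes> inv h"
      unfolding inv2[OF k, symmetric] using h n
      by (simp add: inv_mult_group m_assoc N.mem_carrier)
    have "C = {\<phi> h z, \<phi> ?k (\<phi> h z), \<phi> (?k \<otimes> ?k) (\<phi> h z)}"
      unfolding kinv N_conj_action[OF h(1) n z] N_conj_action[OF h(1) ninv z] nz
      using h(2) by auto
    moreover have "?k \<noteq> \<one>"
    proof
      assume "?k = \<one>"
      then have "\<phi> h x = \<phi> h z"
        using N_conj_action[OF h(1) n z] nz z h(1) by (simp add: action_one action_closed)
      then show False using action_inj h(1) xy z nz n1 N_eq_oneI n by metis
    qed
    ultimately show "C \<in> {{w, \<phi> n w, \<phi> (n \<otimes> n) w} | w n. w \<in> E \<and> n \<in> N \<and> n \<noteq> \<one>}"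
      using k action_closed[OF h(1) z] by blast
  next
    fix C assume "C \<in> {{w, \<phi> n w, \<phi> (n \<otimes> n) w} | w n. w \<in> E \<and> n \<in> N \<and> n \<noteq> \<one>}"
    then obtain w k where C: "C = {w, \<phi> k w, \<phi> (k \<otimes> k) w}"
      and w: "w \<in> E" and k: "k \<in> N" "k \<noteq> \<one>" by blast
    have kw: "\<phi> k w \<in> E" "\<phi> k w \<noteq> w"
      using k w action_closed N.mem_carrier N_eq_oneI by blast+
    \<comment> \<open>\<open>w\<close> and \<open>\<phi> k w\<close> lie in a block with their
      midpoint \<open>c\<close>. Comparing translations yields \<open>k = l\<close>, and then
      \<open>k \<otimes> k\<close> takes \<open>w\<close> to \<open>c\<close>, so this block is
      \<open>C\<close>.\<close>
    obtain c l where c: "c \<in> E" and l: "l \<in> N" and lc: "\<phi> l c = w" "\<phi> (inv l) c = \<phi> k w"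
      and D: "{w, \<phi> k w, c} \<in> \<B>"
      using mid[OF w kw(1) kw(2)[symmetric]] by metis
    have "\<phi> (k \<otimes> l) c = \<phi> (l \<otimes> l) c"
      using lc inv2[OF l] k(1) l c by (simp add: composition_rule N.mem_carrier)
    then have "k \<otimes> l = l \<otimes> l"
      using N_eqI k l c by simp
    then have "k = l"
      using k(1) l by (simp add: N.mem_carrier)
    then have "\<phi> (k \<otimes> k) w = \<phi> (k \<otimes> k \<otimes> k) c"
      using lc(1) l c by (auto simp: composition_rule N.mem_carrier)
    then have "\<phi> (k \<otimes> k) w = c"
      using cube[OF k(1)] c by (simp add: action_one)
    then show "C \<in> \<B>" using C D by simp
  qed
qed

section \<open>Coordinates for the point set over the field with three elements\<close>

text \<open>\<open>f\<close> composes coordinates on \<open>N\<close> with the orbit map of a base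
  point \<open>e\<close>, which is bijective because \<open>N\<close> is regular. Directions of
  lines then become translations.\<close>

lemma cube_blocks_iso_ag_lines:
  assumes cube: "\<And>n. n \<in> N \<Longrightarrow> n [^] (3::nat) = \<one>" and "E \<noteq> {}"
  obtains h f where "bij_betw f (ag_points (residue_ring 3) h) E"
    "(\<lambda>B. f ` B) ` ag_lines (residue_ring 3) h
       = {{w, \<phi> n w, \<phi> (n \<otimes> n) w} | w n. w \<in> E \<and> n \<in> N \<and> n \<noteq> \<one>}"
proof -
  let ?L = "G\<lparr>carrier := N\<rparr>"
  interpret L: comm_group ?L
  proof (rule group.group_comm_groupI)
    show "group ?L" by (rule N.subgroup_is_group) (rule group_axioms)
  qed (simp add: N_comm)
  have prime3: "prime (3::nat)" by simp
  have "finite N" using finite_carrier N.subset by (rule finite_subset[rotated])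
  then obtain h c where c: "L.coordinates 3 h c" and onto: "c ` ag_points (residue_ring 3) h = N"
    using L.elementary_abelian_coordinates[OF prime3, of thesis] cube
    by (simp flip: nat_pow_consistent)
  let ?A = "ag_points (residue_ring 3) h" and ?z = "\<lambda>i\<in>{..<h}. 0::int"
  have inj: "inj_on c ?A"
    and lin: "\<And>a d t. a \<in> ?A \<Longrightarrow> d \<in> ?A \<Longrightarrow> c (affine_comb 3 h a t d) = c a \<otimes> c d [^]\<^bsub>?L\<^esub> (t::int)"
    using c by (auto simp: L.coordinates_def)
  have cN: "c a \<in> N" if "a \<in> ?A" for a using that onto by blast
  obtain e where e: "e \<in> E" using assms(2) by blast
  define f where "f a = \<phi> (c a) e" for a
  have "bij_betw c ?A N" using inj onto by (simp add: bij_betw_def)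
  moreover have "bij_betw (\<lambda>n. \<phi> n e) N E"
  proof (rule bij_betw_imageI)
    show "inj_on (\<lambda>n. \<phi> n e) N" using N_eqI e by (auto intro: inj_onI)
    show "(\<lambda>n. \<phi> n e) ` N = E"
      using N_regular[OF e] action_closed[OF N.mem_carrier e] by blast
  qed
  ultimately have f: "bij_betw f ?A E"
    using bij_betw_trans unfolding f_def comp_def by blast
  \<comment> \<open>The scalars are 0, 1 and 2, and commutativity lets the direction
    \<open>c d\<close> act after \<open>c a\<close>, that is, on the point
    \<open>f a\<close>.\<close>
  have line: "f ` ag_line (residue_ring 3) h a d = {f a, \<phi> (c d) (f a), \<phi> (c d \<otimes> c d) (f a)}"
    if a: "a \<in> ?A" and d: "d \<in> ?A" for a d
  proof -
    have dN: "c d \<in> N" "c d \<in> carrier G" and aN: "c a \<in> N" "c a \<in> carrier G"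
      using cN a d N.mem_carrier by auto
    have comm: "c a \<otimes> n = n \<otimes> c a" if "n \<in> N" for n using N_comm aN that by blast
    have pow: "c d [^]\<^bsub>?L\<^esub> (0::int) = \<one>" "c d [^]\<^bsub>?L\<^esub> (1::int) = c d"
      "c d [^]\<^bsub>?L\<^esub> (2::int) = c d \<otimes> c d"
      using dN L.int_pow_mult[of "c d" 1 1] by simp_all
    have "ag_line (residue_ring 3) h a d = (\<lambda>t. affine_comb 3 h a t d) ` {0, 1, 2}"
    proof -
      have "{0..2::int} = {0, 1, 2}" by auto
      then show ?thesis by (simp add: ag_line_residue_ring)
    qed
    then have "f ` ag_line (residue_ring 3) h a d
        = {\<phi> (c a \<otimes> \<one>) e, \<phi> (c a \<otimes> c d) e, \<phi> (c a \<otimes> (c d \<otimes> c d)) e}"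
      by (simp add: f_def lin[OF a d] pow)
    also have "\<dots> = {f a, \<phi> (c d) (f a), \<phi> (c d \<otimes> c d) (f a)}"
      using dN aN e comm[of "c d"] comm[of "c d \<otimes> c d"]
      by (simp add: f_def composition_rule action_closed)
    finally show ?thesis .
  qed
  have z: "?z \<in> ?A" "c ?z = \<one>"
    using L.coordinates_zero[OF c] by (auto simp: ag_points_def)
  \<comment> \<open>The zero vector has the identity as its image, and \<open>c\<close> is
    injective.\<close>
  have nonzero: "(\<exists>i<h. d i \<noteq> 0) \<longleftrightarrow> c d \<noteq> \<one>" if d: "d \<in> ?A" for d
  proof -
    have "d = ?z \<longleftrightarrow> (\<forall>i<h. d i = 0)"
      using d by (auto simp: ag_points_def PiE_iff fun_eq_iff extensional_def)
    moreover have "c d = c ?z \<longleftrightarrow> d = ?z"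
      using inj d z(1) by (auto dest: inj_onD)
    ultimately show ?thesis using z(2) by auto
  qed
  have "(\<lambda>B. f ` B) ` ag_lines (residue_ring 3) h
      = {{w, \<phi> n w, \<phi> (n \<otimes> n) w} | w n. w \<in> E \<and> n \<in> N \<and> n \<noteq> \<one>}"
  proof (intro subset_antisym subsetI)
    fix X assume "X \<in> (\<lambda>B. f ` B) ` ag_lines (residue_ring 3) h"
    then obtain a d where a: "a \<in> ?A" and d: "d \<in> ?A" "\<exists>i<h. d i \<noteq> 0"
      and X: "X = f ` ag_line (residue_ring 3) h a d"
      by (auto simp: ag_lines_def)
    have "c d \<noteq> \<one>" "f a \<in> E" using nonzero d f a by (auto simp: bij_betw_def)
    then show "X \<in> {{w, \<phi> n w, \<phi> (n \<otimes> n) w} | w n. w \<in> E \<and> n \<in> N \<and> n \<noteq> \<one>}"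
      unfolding X line[OF a d(1)] using cN[OF d(1)] by blast
  next
    fix X assume "X \<in> {{w, \<phi> n w, \<phi> (n \<otimes> n) w} | w n. w \<in> E \<and> n \<in> N \<and> n \<noteq> \<one>}"
    then obtain w n where X: "X = {w, \<phi> n w, \<phi> (n \<otimes> n) w}" and wn: "w \<in> E" "n \<in> N" "n \<noteq> \<one>"
      by blast
    obtain a where a: "a \<in> ?A" "w = f a" using f wn(1) by (auto simp: bij_betw_def)
    obtain d where d: "d \<in> ?A" "n = c d" using onto wn(2) by blast
    have "ag_line (residue_ring 3) h a d \<in> ag_lines (residue_ring 3) h"
      unfolding ag_lines_def residue_ring_simps(4) using nonzero[OF d(1)] a d wn(3) by blast
    then show "X \<in> (\<lambda>B. f ` B) ` ag_lines (residue_ring 3) h"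
      unfolding X a(2) d(2) line[OF a(1) d(1), symmetric] by (rule imageI)
  qed
  with f show ?thesis by (rule that)
qed

end

section \<open>The socle, permutation groups as actions, and the final identification\<close>

lemma (in group) minimal_normal_conj:
  assumes "minimal_normal M G" "h \<in> M" "g \<in> carrier G"
  shows "g \<otimes> h \<otimes> inv g \<in> M"
  using assms(2,3) normal.inv_op_closed2[of M G] assms(1) unfolding minimal_normal_def by blast

text \<open>A union of normal subgroups is closed under conjugation, and this passes to the subgroup
  it generates.\<close>

lemma (in group) socle_normal: "socle G \<lhd> G"
  unfolding socle_def
proof (rule normal_generateI)
  show "\<Union>{N. minimal_normal N G} \<subseteq> carrier G"
    using subgroup.subset normal_imp_subgroup by (force simp: minimal_normal_def)
qed (use minimal_normal_conj in blast)

lemma perm_group_action: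
  assumes "subgroup G (BijGroup P)"
  shows "group_action (perm_group P G) P (\<lambda>g. g)"
proof -
  interpret B: group "BijGroup P" by (rule group_BijGroup)
  interpret group "perm_group P G"
    unfolding perm_group_def using assms B.group_axioms by (rule subgroup.subgroup_is_group)
  show ?thesis
    by unfold_locales
      (use subgroup.subset[OF assms] in \<open>auto simp: hom_def perm_group_def\<close>)
qed

text \<open>The coordinate map runs from the affine space to the points of the design, whereas the
  isomorphism is asked for in the opposite direction.\<close>

lemma design_iso_of_inverse:
  assumes f: "bij_betw f Q P" and img: "(\<lambda>B. f ` B) ` \<C> = \<B>" and sub: "\<And>C. C \<in> \<C> \<Longrightarrow> C \<subseteq> Q"
  shows "design_iso P \<B> Q \<C>"
proof -
  have "inv_into Q f ` f ` C = C" if "C \<in> \<C>" for C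
    using f sub[OF that] by (simp add: bij_betw_def inv_into_image_cancel)
  then have "(\<lambda>B. inv_into Q f ` B) ` \<B> = \<C>"
    unfolding img[symmetric] by (force simp: image_image)
  then show ?thesis
    unfolding design_iso_def using bij_betw_inv_into[OF f] by blast
qed

theorem theorem1p7:
  fixes P :: "'a set" and \<B> :: "'a set set" and v lambda :: nat and G :: "('a \<Rightarrow> 'a) set"
  assumes "nontrivial_2_design P \<B> v 3 lambda"
    and "[v = 1] (mod 6) \<or> [v = 3] (mod 6)"
    and "[v = 6] (mod lambda)"
    and "automorphism_group P \<B> G"
    and "flag_transitive \<B> G"
    and "two_transitive P G"
    and "affine_type P G"
  shows "\<exists>h. design_iso P \<B> (ag_points (residue_ring 3) h) (ag_lines (residue_ring 3) h)"
proof -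
  let ?G = "perm_group P G" and ?N = "socle (perm_group P G)"
  have P: "finite P" "card P = v" "3 < v"
    and blocks: "\<And>B. B \<in> \<B> \<Longrightarrow> B \<subseteq> P \<and> card B = 3"
    and pairs: "\<And>x y. x \<in> P \<Longrightarrow> y \<in> P \<Longrightarrow> x \<noteq> y \<Longrightarrow> card {B \<in> \<B>. x \<in> B \<and> y \<in> B} = lambda"
    using assms(1) by (auto simp: nontrivial_2_design_def is_2_design_def)
  have "odd v"
  proof -
    have "v mod 6 = 1 \<or> v mod 6 = 3" using assms(2) by (simp add: cong_def)
    then show ?thesis by presburger
  qed
  have "odd lambda"
  proof
    assume "even lambda"
    then have "[v = 6] (mod 2)" by (rule cong_dvd_modulus_nat[OF assms(3)])
    then show False using \<open>odd v\<close> by (auto simp: cong_def odd_iff_mod_2_eq_one)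
  qed
  have sub: "subgroup G (BijGroup P)" and auts: "G \<subseteq> design_auts P \<B>"
    using assms(4) by (auto simp: automorphism_group_def)
  have carrier: "carrier ?G = G" by (simp add: perm_group_def)
  interpret A: group_action ?G P "\<lambda>g. g"
    using sub by (rule perm_group_action)
  interpret G: group ?G
    using A.group_hom by (rule group_hom.axioms(1))
  obtain p where "elementary_abelian p (perm_group P ?N)" and reg: "regular_on P ?N"
    using assms(7) by (auto simp: affine_type_def)
  then interpret N: comm_group "perm_group P ?N"
    by (simp add: elementary_abelian_def)
  interpret A: two_transitive_affine_action ?G P "\<lambda>g. g" ?N
  proof (intro two_transitive_affine_action.intro two_transitive_affine_action_axioms.intro)
    show "group_action ?G P (\<lambda>g. g)" by (rule A.group_action_axioms)
    \<comment> \<open>Members of \<open>Bij P\<close> are extensional, hence determined by their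
      values on \<open>P\<close>; this bounds \<open>G\<close> by a finite function space.\<close>
    have "finite (P \<rightarrow>\<^sub>E P)" using P(1) by (intro finite_PiE)
    moreover have "G \<subseteq> P \<rightarrow>\<^sub>E P"
    proof
      fix g assume "g \<in> G"
      then have "g \<in> Bij P" using auts by (auto simp: design_auts_def)
      then show "g \<in> P \<rightarrow>\<^sub>E P"
        by (simp add: PiE_def Bij_imp_funcset Bij_imp_extensional)
    qed
    ultimately show "finite (carrier ?G)" unfolding carrier by (rule finite_subset[rotated])
    show "?N \<lhd> ?G" by (rule G.socle_normal)
    show "\<exists>g\<in>carrier ?G. g x = x' \<and> g y = y'"
      if "x \<in> P" "y \<in> P" "x' \<in> P" "y' \<in> P" "x \<noteq> y" "x' \<noteq> y'" for x y x' y'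
      using assms(6) that unfolding carrier two_transitive_def by blast
    \<comment> \<open>Both \<open>?G\<close> and the group on \<open>?N\<close> inherit their
      multiplication from \<open>BijGroup P\<close>, so commutativity transfers.\<close>
    show "m \<otimes>\<^bsub>?G\<^esub> n = n \<otimes>\<^bsub>?G\<^esub> m" if "m \<in> ?N" "n \<in> ?N" for m n
      using N.m_comm[of m n] that by (simp add: perm_group_def)
    show "\<exists>!n. n \<in> ?N \<and> n x = y" if "x \<in> P" "y \<in> P" for x y
      using reg that by (simp add: regular_on_def)
  qed
  have inv: "g ` B \<in> \<B>" if "g \<in> carrier ?G" "B \<in> \<B>" for g B
    using auts that unfolding carrier design_auts_def by blast
  have flag: "\<exists>g\<in>carrier ?G. g x = y \<and> g ` B = C"
    if "B \<in> \<B>" "C \<in> \<B>" "x \<in> B" "y \<in> C" for B C x y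
    using assms(5) that unfolding carrier flag_transitive_def by blast
  have "\<exists>x\<in>P. \<exists>y\<in>P. x \<noteq> y"
    using P card_le_Suc0_iff_eq[of P] by auto
  \<comment> \<open>The placeholder is the parity hypothesis, discharged below from
    \<open>pairs\<close> and the oddness of \<open>lambda\<close>.\<close>
  note triple = A.triple_system_blocks[of \<B>, OF blocks _ inv flag this]
  have cube: "\<And>n. n \<in> ?N \<Longrightarrow> n [^]\<^bsub>?G\<^esub> (3::nat) = \<one>\<^bsub>?G\<^esub>"
    and char: "\<B> = {{w, n w, (n \<otimes>\<^bsub>?G\<^esub> n) w} | w n. w \<in> P \<and> n \<in> ?N \<and> n \<noteq> \<one>\<^bsub>?G\<^esub>}"
    using triple pairs \<open>odd lambda\<close> by simp_all
  have "P \<noteq> {}" using P by auto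
  then obtain h f where f: "bij_betw f (ag_points (residue_ring 3) h) P"
      "(\<lambda>B. f ` B) ` ag_lines (residue_ring 3) h = \<B>"
    using A.cube_blocks_iso_ag_lines[OF cube] unfolding char[symmetric] by metis
  \<comment> \<open>Lines consist of points of the affine space, so the inverse of \<open>f\<close>
    undoes the image of a line under \<open>f\<close>.\<close>
  have "C \<subseteq> ag_points (residue_ring 3) h" if "C \<in> ag_lines (residue_ring 3) h" for C
    using that affine_comb_closed[of 3 h] by (auto simp: ag_lines_def ag_line_residue_ring)
  then show ?thesis
    using design_iso_of_inverse[OF f] by blast
qed

end
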